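(* Let $\kappa>0$, $\lambda>0$, and $\lambda<1+\kappa$, and let $\boldsymbol{P}_A$ and $\boldsymbol{P}_B$ be the one-step transition matrices of the history-dependent Parrondo games $A$ and $B$ with bias parameter absent (i.e. equal to $0$). If $\gamma\in(0,1)$ and $C:=\gamma A+(1-\gamma)B$ is the random mixture, with one-step transition matrix $\boldsymbol{P}_C=\gamma\boldsymbol{P}_A+(1-\gamma)\boldsymbol{P}_B$, then the asymptotic mean profit per game $\mu_C(0)$ satisfies: $\mu_C(0)>0$ whenever $\kappa<\lambda<1$ or $\kappa>\lambda>1$; $\mu_C(0)=0$ whenever $\kappa=\lambda$ or $\lambda=1$; and $\mu_C(0)<0$ whenever $\lambda<\min(\kappa,1)$ or $\lambda>\max(\kappa,1)$.
   Context: For $p_0,p_1,p_2,p_3\in(0,1)$ consider the matrix on state space $\Sigma=\{0,1,2,3\}$ $$\boldsymbol{P}(p_0,p_1,p_2,p_3):=\begin{pmatrix}1-p_0&p_0&0&0\\0&0&1-p_1&p_1\\1-p_2&p_2&0&0\\0&0&1-p_3&p_3\end{pmatrix}.$$ (States $0,1,2,3$, in binary $00,01,10,11$, represent loss-loss, loss-win, win-loss, win-win for the two preceding games, the more recent result listed second; $p_i$ is the probability of winning one unit from state $i$, and with probability $1-p_i$ one unit is lost.) This matrix is irreducible and aperiodic; if $\boldsymbol{\pi}=(\pi_0,\pi_1,\pi_2,\pi_3)$ is its unique stationary distribution, the asymptotic mean profit per game played is $\mu:=\sum_{i=0}^3\pi_i(p_i-(1-p_i))$. With bias parameter $0$: game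 $A$ has $\boldsymbol{P}_A:=\boldsymbol{P}(\tfrac12,\tfrac12,\tfrac12,\tfrac12)$, and game $B$ has $\boldsymbol{P}_B:=\boldsymbol{P}(p_0,p_1,p_2,p_3)$ with $p_0:=\frac1{1+\kappa}$, $p_1=p_2:=\frac{\lambda}{1+\lambda}$, $p_3:=1-\frac{\lambda}{1+\kappa}$. The matrix $\boldsymbol{P}_C$ is again of the form $\boldsymbol{P}(\cdot)$, and $\mu_C(0)$ denotes its mean $\mu$. *)

theory Defs
  imports "HOL-Analysis.Analysis"
begin

text \<open>
  The state space is the numeral type \<^typ>\<open>4\<close>, whose arithmetic is modulo 4.  A state is
  \<open>2 * a + b\<close> with \<open>a\<close> the older and \<open>b\<close> the more recent result (1 = win, 0 = loss).  After a
  further result \<open>c\<close> it becomes \<open>2 * b + c\<close>, which is \<open>2 * i + c\<close> modulo 4.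
\<close>

definition history_matrix :: "real^4 \<Rightarrow> real^4^4" where
  "history_matrix p =
     (\<chi> i j. if j = 2 * i then 1 - p $ i else if j = 2 * i + 1 then p $ i else 0)"

definition stationary_distribution :: "real^4^4 \<Rightarrow> real^4 \<Rightarrow> bool" where
  "stationary_distribution P \<pi> \<longleftrightarrow>
     (\<forall>i. 0 \<le> \<pi> $ i) \<and> (\<Sum>i\<in>UNIV. \<pi> $ i) = 1 \<and> \<pi> v* P = \<pi>"

text \<open>
  The two descriptions below are unique whenever \<open>P = history_matrix p\<close> with all \<open>p $ i\<close> strictly
  between 0 and 1 (lemmas \<open>history_matrix_inject\<close> and \<open>ex1_stationary_distribution\<close>).
\<close>

definition mean_profit :: "real^4^4 \<Rightarrow> real" where
  "mean_profit P =
     (let p = (THE p. P = history_matrix p);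
          \<pi> = (THE \<pi>. stationary_distribution P \<pi>)
      in \<Sum>i\<in>UNIV. \<pi> $ i * (p $ i - (1 - p $ i)))"

definition P_A :: "real^4^4" where
  "P_A = history_matrix (\<chi> i. 1 / 2)"

definition P_B :: "real \<Rightarrow> real \<Rightarrow> real^4^4" where
  "P_B \<kappa> lam = history_matrix
     (\<chi> i. if i = 0 then 1 / (1 + \<kappa>) else if i = 3 then 1 - lam / (1 + \<kappa>) else lam / (1 + lam))"

lemma four_eq_0: "(4::4) = 0"
  by simp

lemma UNIV_state: "(UNIV :: 4 set) = {0, 1, 2, 3}"
  unfolding UNIV_4 four_eq_0 by blast

lemma all_state: "(\<forall>i::4. Q i) \<longleftrightarrow> Q 0 \<and> Q 1 \<and> Q 2 \<and> Q 3"
  by (metis (full_types) UNIV_I UNIV_state empty_iff insert_iff)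

lemma sum_state: "(\<Sum>i\<in>(UNIV :: 4 set). f i) = f 0 + f 1 + f 2 + (f 3 :: real)"
  unfolding sum_4 four_eq_0 by (rule add.commute[THEN trans]) (simp only: add.assoc)

lemma history_matrix_rows:
  "history_matrix p $ 0 $ j = (if j = 0 then 1 - p $ 0 else if j = 1 then p $ 0 else 0)"
  "history_matrix p $ 1 $ j = (if j = 2 then 1 - p $ 1 else if j = 3 then p $ 1 else 0)"
  "history_matrix p $ 2 $ j = (if j = 0 then 1 - p $ 2 else if j = 1 then p $ 2 else 0)"
  "history_matrix p $ 3 $ j = (if j = 2 then 1 - p $ 3 else if j = 3 then p $ 3 else 0)"
  by (simp_all add: history_matrix_def)

lemma history_matrix_inject: "history_matrix p = history_matrix q \<longleftrightarrow> p = q"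
  by (auto simp: history_matrix_def vec_eq_iff all_state)

lemma history_matrix_mixture:
  "\<gamma> *\<^sub>R history_matrix p + (1 - \<gamma>) *\<^sub>R history_matrix q =
   history_matrix (\<gamma> *\<^sub>R p + (1 - \<gamma>) *\<^sub>R q)"
  by (simp add: history_matrix_def vec_eq_iff algebra_simps)

lemma stationary_distribution_history_matrix:
  "stationary_distribution (history_matrix p) \<pi> \<longleftrightarrow>
     (\<forall>i. 0 \<le> \<pi> $ i) \<and> \<pi> $ 0 + \<pi> $ 1 + \<pi> $ 2 + \<pi> $ 3 = 1 \<and>
     (1 - p $ 0) * \<pi> $ 0 + (1 - p $ 2) * \<pi> $ 2 = \<pi> $ 0 \<and>
     p $ 0 * \<pi> $ 0 + p $ 2 * \<pi> $ 2 = \<pi> $ 1 \<and>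
     (1 - p $ 1) * \<pi> $ 1 + (1 - p $ 3) * \<pi> $ 3 = \<pi> $ 2 \<and>
     p $ 1 * \<pi> $ 1 + p $ 3 * \<pi> $ 3 = \<pi> $ 3"
  by (simp add: stationary_distribution_def vector_matrix_mult_def vec_eq_iff sum_state
      history_matrix_def mult.commute all_state[of "\<lambda>j. _ j = \<pi> $ j"])

lemma ex1_stationary_distribution:
  assumes p: "\<And>i. 0 < p $ i" "\<And>i. p $ i < 1"
  shows "\<exists>!\<pi>. stationary_distribution (history_matrix p) \<pi>"
proof -
  define a where "a = (1 - p $ 2) / p $ 0"
  define b where "b = p $ 1 / (1 - p $ 3)"
  define s where "s = a + 2 + b"
  have nz: "p $ 0 \<noteq> 0" "1 - p $ 3 \<noteq> 0" using p(1)[of 0] p(2)[of 3] by auto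
  have ab: "a > 0" "b > 0" unfolding a_def b_def using p by auto
  then have s: "s > 0" by (simp add: s_def)
  have a: "p $ 0 * a = 1 - p $ 2" and b: "(1 - p $ 3) * b = p $ 1"
    using nz by (simp_all add: a_def b_def)
  define w :: "real^4" where
    "w = (\<chi> i. (if i = 0 then a else if i = 3 then b else 1) / s)"
  show ?thesis
  proof (rule ex1I[of _ w])
    have w: "w $ 0 = a / s" "w $ 1 = 1 / s" "w $ 2 = 1 / s" "w $ 3 = b / s"
      by (simp_all add: w_def)
    have eqs: "(1 - p $ 0) * a + (1 - p $ 2) = a" "p $ 0 * a + p $ 2 = 1"
      "(1 - p $ 1) + (1 - p $ 3) * b = 1" "p $ 1 + p $ 3 * b = b"
      using a b by (simp_all add: algebra_simps)
    show "stationary_distribution (history_matrix p) w"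
      unfolding stationary_distribution_history_matrix
    proof (intro conjI)
      show "\<forall>i. 0 \<le> w $ i" using ab s by (simp add: w_def)
      show "w $ 0 + w $ 1 + w $ 2 + w $ 3 = 1"
        unfolding w add_divide_distrib[symmetric] using s by (simp add: s_def)
      show "(1 - p $ 0) * w $ 0 + (1 - p $ 2) * w $ 2 = w $ 0"
        "p $ 0 * w $ 0 + p $ 2 * w $ 2 = w $ 1"
        "(1 - p $ 1) * w $ 1 + (1 - p $ 3) * w $ 3 = w $ 2"
        "p $ 1 * w $ 1 + p $ 3 * w $ 3 = w $ 3"
        unfolding w times_divide_eq_right add_divide_distrib[symmetric] mult_1_right eqs
        by (rule refl)+
    qed
  next
    fix \<pi> assume "stationary_distribution (history_matrix p) \<pi>"
    then have e: "\<pi> $ 0 + \<pi> $ 1 + \<pi> $ 2 + \<pi> $ 3 = 1"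
      "(1 - p $ 0) * \<pi> $ 0 + (1 - p $ 2) * \<pi> $ 2 = \<pi> $ 0"
      "p $ 0 * \<pi> $ 0 + p $ 2 * \<pi> $ 2 = \<pi> $ 1"
      "p $ 1 * \<pi> $ 1 + p $ 3 * \<pi> $ 3 = \<pi> $ 3"
      unfolding stationary_distribution_history_matrix by auto
    have 1: "\<pi> $ 1 = \<pi> $ 2" using e(2,3) by (simp add: algebra_simps)
    have 0: "\<pi> $ 0 = a * \<pi> $ 2"
      using e(2) nz by (simp add: a_def field_simps)
    have 3: "\<pi> $ 3 = b * \<pi> $ 2"
      using e(4) nz 1 by (simp add: b_def field_simps)
    have "s * \<pi> $ 2 = 1" using e(1) unfolding 0 1 3 s_def by (simp add: algebra_simps)
    then have 2: "\<pi> $ 2 = 1 / s" using s by (simp add: field_simps)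
    show "\<pi> = w"
      unfolding vec_eq_iff all_state by (simp add: 0 1 3 2 w_def)
  qed
qed

end

theory Submission
  imports Defs
begin

text \<open>
  The stationary distribution is explicit, so the mean profit of \<open>history_matrix p\<close> is a positive
  multiple of \<open>p\<^sub>0 p\<^sub>1 - (1 - p\<^sub>2) (1 - p\<^sub>3)\<close>.  This quantity vanishes for both \<open>A\<close> and \<open>B\<close>; it is
  quadratic in \<open>p\<close>, so for the mixture only the cross term survives, which is
  \<open>\<gamma> (1 - \<gamma>) / 2\<close> times \<open>(1 - lam) (lam - \<kappa>) / ((1 + \<kappa>) (1 + lam))\<close>.
\<close>

text \<open>Stationarity makes every \<open>\<pi> $ i\<close> a multiple of
  \<open>\<pi> $ 2\<close>, normalisation fixes \<open>\<pi> $ 2\<close>, and the profit collapses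
  to \<open>\<pi> $ 3 - \<pi> $ 0\<close>.\<close>

lemma mean_profit_history_matrix:
  assumes p: "\<And>i. 0 < p $ i" "\<And>i. p $ i < 1"
  shows "mean_profit (history_matrix p) =
    (p $ 0 * p $ 1 - (1 - p $ 2) * (1 - p $ 3)) /
    ((1 - p $ 2) * (1 - p $ 3) + 2 * (p $ 0 * (1 - p $ 3)) + p $ 0 * p $ 1)"
    (is "_ = ?N / ?D")
proof -
  obtain \<pi> where \<pi>: "stationary_distribution (history_matrix p) \<pi>"
    using ex1_stationary_distribution[OF p] by blast
  have the_p: "(THE q. history_matrix p = history_matrix q) = p"
    by (simp add: history_matrix_inject)
  have the_\<pi>: "(THE \<pi>. stationary_distribution (history_matrix p) \<pi>) = \<pi>"
    using ex1_stationary_distribution[OF p] \<pi> by (rule the1_equality)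
  have total: "\<pi> $ 0 + \<pi> $ 1 + \<pi> $ 2 + \<pi> $ 3 = 1"
    and e0: "(1 - p $ 0) * \<pi> $ 0 + (1 - p $ 2) * \<pi> $ 2 = \<pi> $ 0"
    and e1: "p $ 0 * \<pi> $ 0 + p $ 2 * \<pi> $ 2 = \<pi> $ 1"
    and e3: "p $ 1 * \<pi> $ 1 + p $ 3 * \<pi> $ 3 = \<pi> $ 3"
    using \<pi> unfolding stationary_distribution_history_matrix by auto
  \<comment> \<open>States 0 and 2 both move into 0 or 1, so adding \<open>e0\<close> and
    \<open>e1\<close> equates the masses of {0, 2} and {0, 1}.\<close>
  have eq12: "\<pi> $ 1 = \<pi> $ 2"
    using e0 e1 by (simp add: algebra_simps)
  have eq0: "p $ 0 * \<pi> $ 0 = (1 - p $ 2) * \<pi> $ 2"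
    using e0 by (simp add: algebra_simps)
  have eq3: "(1 - p $ 3) * \<pi> $ 3 = p $ 1 * \<pi> $ 2"
    using e3 eq12 by (simp add: algebra_simps)
  \<comment> \<open>The common denominator of \<open>\<pi> $ 0\<close> and \<open>\<pi> $ 3\<close>
    when solved in terms of \<open>\<pi> $ 2\<close>.\<close>
  define c where "c = p $ 0 * (1 - p $ 3)"
  have c: "c > 0" using p by (simp add: c_def)
  have c0: "c * \<pi> $ 0 = (1 - p $ 2) * (1 - p $ 3) * \<pi> $ 2"
    using arg_cong[OF eq0, of "\<lambda>x. (1 - p $ 3) * x"] by (simp add: c_def mult_ac)
  have c3: "c * \<pi> $ 3 = p $ 0 * p $ 1 * \<pi> $ 2"
    using arg_cong[OF eq3, of "\<lambda>x. p $ 0 * x"] by (simp add: c_def mult_ac)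
  have "?D * \<pi> $ 2 = c * \<pi> $ 0 + 2 * (c * \<pi> $ 2) + c * \<pi> $ 3"
    unfolding c0 c3 by (simp add: c_def algebra_simps)
  also have "\<dots> = c * (\<pi> $ 0 + \<pi> $ 1 + \<pi> $ 2 + \<pi> $ 3)"
    unfolding eq12 by (simp add: algebra_simps)
  finally have D: "?D * \<pi> $ 2 = c" using total by simp
  \<comment> \<open>The two brackets add up to the probability of a win, which by stationarity is
    \<open>\<pi> $ 1 + \<pi> $ 3\<close>.\<close>
  have "mean_profit (history_matrix p) =
      2 * (p $ 0 * \<pi> $ 0 + p $ 2 * \<pi> $ 2) + 2 * (p $ 1 * \<pi> $ 1 + p $ 3 * \<pi> $ 3)
      - (\<pi> $ 0 + \<pi> $ 1 + \<pi> $ 2 + \<pi> $ 3)"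
    unfolding mean_profit_def Let_def the_p the_\<pi> sum_state by (simp add: algebra_simps)
  also have "\<dots> = \<pi> $ 3 - \<pi> $ 0"
    unfolding e1 e3 using eq12 by simp
  finally have "c * mean_profit (history_matrix p) = c * \<pi> $ 3 - c * \<pi> $ 0"
    by (simp add: right_diff_distrib)
  also have "\<dots> = ?N * \<pi> $ 2"
    unfolding c0 c3 by (simp add: left_diff_distrib)
  \<comment> \<open>Replacing \<open>c\<close> by \<open>?D * \<pi> $ 2\<close> puts the factor
    \<open>\<pi> $ 2\<close> on both sides, where it cancels.\<close>
  finally have "\<pi> $ 2 * (?D * mean_profit (history_matrix p)) = \<pi> $ 2 * ?N"
    unfolding D[symmetric] by (simp only: mult_ac)
  moreover have "\<pi> $ 2 \<noteq> 0" using D c by auto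
  ultimately have "?D * mean_profit (history_matrix p) = ?N" by simp
  moreover have "?D > 0"
    using p by (intro add_pos_pos mult_pos_pos) simp_all
  ultimately show ?thesis by (simp add: nonzero_eq_divide_eq mult.commute)
qed

text \<open>The denominator is positive, so all three cases of the theorem can be read off one
  polynomial.\<close>

corollary sgn_mean_profit_history_matrix:
  assumes p: "\<And>i. 0 < p $ i" "\<And>i. p $ i < 1"
  shows "sgn (mean_profit (history_matrix p)) =
    sgn (p $ 0 * p $ 1 - (1 - p $ 2) * (1 - p $ 3))"
proof -
  have "(1 - p $ 2) * (1 - p $ 3) + 2 * (p $ 0 * (1 - p $ 3)) + p $ 0 * p $ 1 > 0"
    using p by (intro add_pos_pos mult_pos_pos) simp_all
  then show ?thesis
    by (simp add: mean_profit_history_matrix[OF p] divide_inverse sgn_mult)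
qed

theorem theorem4:
  fixes \<kappa> lam \<gamma> :: real and P_C :: "real^4^4"
  assumes "\<kappa> > 0" and "lam > 0" and "lam < 1 + \<kappa>"
    and "0 < \<gamma>" and "\<gamma> < 1"
    and "P_C = \<gamma> *\<^sub>R P_A + (1 - \<gamma>) *\<^sub>R P_B \<kappa> lam"
  shows "((\<kappa> < lam \<and> lam < 1) \<or> (\<kappa> > lam \<and> lam > 1) \<longrightarrow> mean_profit P_C > 0) \<and>
         (\<kappa> = lam \<or> lam = 1 \<longrightarrow> mean_profit P_C = 0) \<and>
         (lam < min \<kappa> 1 \<or> lam > max \<kappa> 1 \<longrightarrow> mean_profit P_C < 0)"
proof -
  define b :: "real^4" where
    "b = (\<chi> i. if i = 0 then 1 / (1 + \<kappa>) else if i = 3 then 1 - lam / (1 + \<kappa>) else lam / (1 + lam))"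
  define p where "p = \<gamma> *\<^sub>R (\<chi> i. 1 / 2) + (1 - \<gamma>) *\<^sub>R b"
  have P_C: "P_C = history_matrix p"
    unfolding assms(6) P_A_def P_B_def p_def b_def by (rule history_matrix_mixture)
  have b: "0 < b $ i" "b $ i < 1" for i
    using assms(1-3) by (auto simp: b_def)
  have pi: "p $ i = \<gamma> / 2 + (1 - \<gamma>) * b $ i" for i
    by (simp add: p_def)
  have p: "0 < p $ i" "p $ i < 1" for i
  proof -
    show "0 < p $ i" unfolding pi using b(1)[of i] assms(4,5) by (simp add: add_pos_pos)
    have "(1 - \<gamma>) * b $ i < 1 - \<gamma>"
      using b(2)[of i] assms(5) by simp
    then have "p $ i < \<gamma> / 2 + (1 - \<gamma>)" unfolding pi by simp
    also have "\<dots> < 1" using assms(4) by simp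
    finally show "p $ i < 1" .
  qed
  define u v where "u = 1 / (1 + \<kappa>)" and "v = 1 / (1 + lam)"
  have u: "u > 0" and v: "v > 0" using assms(1,2) by (simp_all add: u_def v_def)
  have lv: "lam * v = 1 - v" using assms(2) by (simp add: v_def field_simps)
  \<comment> \<open>The equal entries 1 and 2 are written differently so that both products in the
    criterion for \<open>b\<close> are visibly \<open>lam * u * v\<close>.\<close>
  have bv: "b $ 0 = u" "b $ 1 = lam * v" "b $ 2 = 1 - v" "b $ 3 = 1 - lam * u"
    using lv by (simp_all add: b_def u_def v_def)
  \<comment> \<open>The pure terms of \<open>A\<close> and \<open>B\<close> cancel; the cross term
    carries \<open>u + lam * v - v - lam * u\<close>.\<close>
  have "p $ 0 * p $ 1 - (1 - p $ 2) * (1 - p $ 3) = \<gamma> * (1 - \<gamma>) / 2 * ((1 - lam) * (u - v))"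
    unfolding pi bv by (simp add: field_simps)
  also have "u - v = u * v * (lam - \<kappa>)"
    using assms(1,2) by (simp add: u_def v_def field_simps)
  finally have "sgn (mean_profit P_C) = sgn (\<gamma> * (1 - \<gamma>) / 2 * ((1 - lam) * (u * v * (lam - \<kappa>))))"
    unfolding P_C sgn_mean_profit_history_matrix[OF p] by (rule arg_cong)
  then have sgn: "sgn (mean_profit P_C) = sgn (1 - lam) * sgn (lam - \<kappa>)"
    using assms(4,5) u v by (simp add: sgn_mult)
  show ?thesis
  proof (intro conjI impI)
    assume "(\<kappa> < lam \<and> lam < 1) \<or> (\<kappa> > lam \<and> lam > 1)"
    then have "sgn (mean_profit P_C) = 1" unfolding sgn by auto
    then show "mean_profit P_C > 0" by (simp add: sgn_1_pos)
  next
    assume "\<kappa> = lam \<or> lam = 1"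
    then have "sgn (mean_profit P_C) = 0" unfolding sgn by auto
    then show "mean_profit P_C = 0" by (simp add: sgn_0_0)
  next
    assume "lam < min \<kappa> 1 \<or> lam > max \<kappa> 1"
    then have "sgn (mean_profit P_C) = -1" unfolding sgn by auto
    then show "mean_profit P_C < 0" by (simp add: sgn_1_neg)
  qed
qed

end
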